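(* Let $m\geqslant 2$ and $k\geqslant 2$. The shortest pair of distinct factors of $\mathbf{t}_m$ that are $k$-binomially equivalent have length $2m^{k-1}$. In particular, for every length $n<2m^{k-1}$, the $k$-binomial complexity $b^{(k)}_{\mathbf{t}_m}(n)$ coincides with the factor complexity $p_{\mathbf{t}_m}(n)$.
   Context: Let $\mathcal{A}_m=\{0,1,\ldots,m-1\}$, identified with $\mathbb{Z}/m\mathbb{Z}$ (all letter arithmetic is modulo $m$). Let $\sigma_m:\mathcal{A}_m^*\to\mathcal{A}_m^*$ be the morphism $\sigma_m(i)=i\,(i+1)\cdots(i+m-1)$, and let $\mathbf{t}_m=\lim_{j\to\infty}\sigma_m^j(0)$ be the generalized Thue--Morse word. A factor of a word is a block of consecutive letters; a subword is a (not necessarily contiguous) subsequence. For words $u,w$, the binomial coefficient $\binom{u}{w}$ is the number of occurrences of $w$ as a subword of $u$. Two words $u,v$ are $k$-binomially equivalent, $u\sim_k v$, if $\binom{u}{x}=\binom{v}{x}$ for all words $x$ of length at most $k$. The $k$-binomial complexity $b^{(k)}_{\mathbf{t}_m}(n)$ is the number of $\sim_k$-classes of the set of factors of length $n$ of $\mathbf{t}_m$, and $p_{\mathbf{t}_m}(n)$ is the number of factors of length $n$ of $\mathbf{t}_m$. *)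

theory Defs
  imports Complex_Main "HOL-Library.Sublist"
begin

text \<open>Letters of the alphabet \<open>{0, \<dots>, m - 1}\<close> are natural numbers, finite words are lists
  and infinite words are functions on \<open>nat\<close>, indexed from \<open>0\<close>.\<close>

definition sigma :: "nat \<Rightarrow> nat list \<Rightarrow> nat list" where
  "sigma m w = concat (map (\<lambda>i. map (\<lambda>r. (i + r) mod m) [0..<m]) w)"

text \<open>Letterwise limit of a sequence of finite words; it is meaningful only if every position is
  eventually present and constant. For the words \<open>\<sigma>\<^sub>m\<^sup>j(0)\<close> this is \<open>eventually_thue_morse\<close> below.\<close>

definition word_lim :: "(nat \<Rightarrow> 'a list) \<Rightarrow> nat \<Rightarrow> 'a" where
  "word_lim W n = (THE a. \<forall>\<^sub>F j in sequentially. n < length (W j) \<and> W j ! n = a)"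

definition thue_morse :: "nat \<Rightarrow> nat \<Rightarrow> nat" where
  "thue_morse m = word_lim (\<lambda>j. (sigma m ^^ j) [0])"

definition factors :: "(nat \<Rightarrow> 'a) \<Rightarrow> 'a list set" where
  "factors x = {map x [i..<i + n] | i n. True}"

definition factors_of_length :: "(nat \<Rightarrow> 'a) \<Rightarrow> nat \<Rightarrow> 'a list set" where
  "factors_of_length x n = {w \<in> factors x. length w = n}"

text \<open>An occurrence of \<open>w\<close> as a subword of \<open>u\<close> is the set of positions of \<open>u\<close> that it uses.\<close>

definition word_binomial :: "'a list \<Rightarrow> 'a list \<Rightarrow> nat" where
  "word_binomial u w = card {I. I \<subseteq> {..<length u} \<and> nths u I = w}"

text \<open>The words \<open>x\<close> below range over the whole letter type; letters that occur in neither
  \<open>u\<close> nor \<open>v\<close> contribute only the trivial condition \<open>0 = 0\<close>.\<close>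

definition binomially_equivalent :: "nat \<Rightarrow> 'a list \<Rightarrow> 'a list \<Rightarrow> bool" where
  "binomially_equivalent k u v \<longleftrightarrow>
     (\<forall>x. length x \<le> k \<longrightarrow> word_binomial u x = word_binomial v x)"

definition binomial_complexity :: "nat \<Rightarrow> (nat \<Rightarrow> 'a) \<Rightarrow> nat \<Rightarrow> nat" where
  "binomial_complexity k x n =
     card (factors_of_length x n // {(u, v). u \<in> factors_of_length x n \<and>
       v \<in> factors_of_length x n \<and> binomially_equivalent k u v})"

definition factor_complexity :: "(nat \<Rightarrow> 'a) \<Rightarrow> nat \<Rightarrow> nat" where
  "factor_complexity x n = card (factors_of_length x n)"

lemma sigma_append: "sigma m (u @ v) = sigma m u @ sigma m v"
  by (simp add: sigma_def)

lemma funpow_sigma_append: "(sigma m ^^ j) (u @ v) = (sigma m ^^ j) u @ (sigma m ^^ j) v"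
  by (induction j) (simp_all add: sigma_append)

lemma length_sigma: "length (sigma m w) = m * length w"
  by (induction w) (simp_all add: sigma_def)

lemma length_funpow_sigma: "length ((sigma m ^^ j) w) = m ^ j * length w"
  by (induction j) (simp_all add: length_sigma)

lemma prefix_funpow_sigma:
  assumes "m \<ge> 1" "i \<le> j"
  shows "prefix ((sigma m ^^ i) [0]) ((sigma m ^^ j) [0])"
  using assms(2)
proof (induction j rule: dec_induct)
  case base
  show ?case by simp
next
  case (step j)
  have "sigma m [0] = [0] @ map (\<lambda>r. r mod m) [1..<m]"
    using assms(1) by (simp add: sigma_def upt_conv_Cons)
  then have "(sigma m ^^ Suc j) [0]
      = (sigma m ^^ j) [0] @ (sigma m ^^ j) (map (\<lambda>r. r mod m) [1..<m])"
    by (simp only: funpow_Suc_right comp_apply funpow_sigma_append)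
  then have "prefix ((sigma m ^^ j) [0]) ((sigma m ^^ Suc j) [0])"
    by (rule prefixI)
  then show ?case
    using step.IH prefix_order.trans by blast
qed

lemma eventually_thue_morse:
  assumes "m \<ge> 2"
  shows "\<forall>\<^sub>F j in sequentially.
    n < length ((sigma m ^^ j) [0]) \<and> (sigma m ^^ j) [0] ! n = thue_morse m n"
proof -
  define W where "W j = (sigma m ^^ j) [0]" for j
  have "n < 2 ^ n" by (rule less_exp)
  also have "(2::nat) ^ n \<le> m ^ n" using assms by (intro power_mono) simp_all
  finally have len: "n < length (W n)"
    by (simp add: W_def length_funpow_sigma)
  have "n < length (W j) \<and> W j ! n = W n ! n" if "j \<ge> n" for j
    using prefix_funpow_sigma[of m n j] that assms len
    by (auto simp: W_def prefix_def nth_append)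
  then have ev: "\<forall>\<^sub>F j in sequentially. n < length (W j) \<and> W j ! n = W n ! n"
    by (rule eventually_sequentiallyI)
  have "b = a" if "\<forall>\<^sub>F j in sequentially. n < length (W j) \<and> W j ! n = a"
      "\<forall>\<^sub>F j in sequentially. n < length (W j) \<and> W j ! n = b" for a b
  proof -
    from that have "\<forall>\<^sub>F j in sequentially. b = a"
      by eventually_elim simp
    then show ?thesis by simp
  qed
  then have "thue_morse m n = W n ! n"
    unfolding thue_morse_def word_lim_def W_def[symmetric] using ev
    by (intro the_equality) blast+
  then show ?thesis using ev by (simp add: W_def)
qed

end

theory Submission
  imports Defs "HOL-Computational_Algebra.Polynomial"
begin

text \<open>Existence: if \<open>X \<sim>\<^sub>k Y\<close> then \<open>X Y \<sim>\<^sub>k\<^sub>+\<^sub>1 Y X\<close>. The words \<open>\<sigma>(a)\<close> are rotations of each other,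
  so \<open>\<sigma>\<^sup>k(a) \<sim>\<^sub>k \<sigma>\<^sup>k(b)\<close> for all letters by induction on \<open>k\<close>, and \<open>\<sigma>\<^sup>k\<^sup>-\<^sup>1(01) \<sim>\<^sub>k \<sigma>\<^sup>k\<^sup>-\<^sup>1(10)\<close>.

  Minimality: if \<open>u \<sim>\<^sub>k v\<close>, then the moments \<open>\<Sum>\<^sub>i p(i) f(u\<^sub>i)\<close> agree for \<open>u\<close> and \<open>v\<close>, for all
  polynomials \<open>p\<close> of degree less than \<open>k\<close> and all functions \<open>f\<close> on letters. This weaker relation
  suffices for the lower bound, by induction on \<open>k\<close>. Cancel common prefixes and suffixes, so that
  \<open>u\<close> and \<open>v\<close> differ at both ends. The sum of \<open>p(i + 1) f(u\<^sub>i + 1) - p(i) f(u\<^sub>i)\<close> over all \<open>i\<close>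
  telescopes inside the blocks \<open>\<sigma>(b)\<close>. For \<open>p(x) = x\<close> and \<open>p(x) = 1\<close> it shows that \<open>u\<close> and \<open>v\<close>
  end, respectively start, at block boundaries, so \<open>u = \<sigma>(u')\<close> and \<open>v = \<sigma>(v')\<close>; for general \<open>p\<close>
  it then shows that the moments of \<open>u'\<close> and \<open>v'\<close> agree up to one order less.\<close>

section \<open>Binomial coefficients of words\<close>

definition occurrences :: "'a list \<Rightarrow> 'a list \<Rightarrow> nat set set" where
  "occurrences u x = {I. I \<subseteq> {..<length u} \<and> nths u I = x}"

lemma word_binomial_eq_card_occurrences: "word_binomial u x = card (occurrences u x)"
  by (simp add: word_binomial_def occurrences_def)

lemma finite_occurrences: "finite (occurrences u x)"
  by (rule finite_subset[of _ "Pow {..<length u}"]) (auto simp: occurrences_def)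

lemma length_nths_subset: "I \<subseteq> {..<length u} \<Longrightarrow> length (nths u I) = card I"
  by (auto simp: length_nths intro: arg_cong[of _ _ card])

lemma occurrences_Nil_right: "occurrences u [] = {{}}"
proof -
  have "I = {}" if "I \<subseteq> {..<length u}" "nths u I = []" for I
    using that length_nths_subset[of I u] finite_subset[of I "{..<length u}"] by simp
  then show ?thesis by (auto simp: occurrences_def)
qed

lemma occurrences_snoc:
  "occurrences (u @ [b]) (x @ [a])
    = occurrences u (x @ [a]) \<union> (if a = b then insert (length u) ` occurrences u x else {})"
proof -
  let ?n = "length u"
  have without_last: "nths (u @ [b]) I = nths u I" if "I \<subseteq> {..<?n}" for I
    using that by (auto simp: nths_append)
  have with_last: "nths (u @ [b]) (insert ?n I) = nths u I @ [b]" for I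
  proof -
    have "nths u (insert ?n I) = nths u I"
      unfolding nths_def by (intro arg_cong[of _ _ "map fst"] filter_cong refl) (auto simp: set_zip)
    then show ?thesis by (simp add: nths_append)
  qed
  have "occurrences (u @ [b]) (x @ [a]) = {I \<in> Pow (insert ?n {..<?n}). nths (u @ [b]) I = x @ [a]}"
    by (simp add: occurrences_def lessThan_Suc)
  also have "\<dots> = {I \<in> Pow {..<?n}. nths (u @ [b]) I = x @ [a]}
      \<union> insert ?n ` {I \<in> Pow {..<?n}. nths (u @ [b]) (insert ?n I) = x @ [a]}"
    unfolding Pow_insert by blast
  also have "{I \<in> Pow {..<?n}. nths (u @ [b]) I = x @ [a]} = occurrences u (x @ [a])"
    by (auto simp: occurrences_def without_last)
  also have "insert ?n ` {I \<in> Pow {..<?n}. nths (u @ [b]) (insert ?n I) = x @ [a]}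
      = (if a = b then insert ?n ` occurrences u x else {})"
    by (simp add: occurrences_def with_last eq_commute[of b])
  finally show ?thesis .
qed

lemma word_binomial_Nil_right [simp]: "word_binomial u [] = 1"
  by (simp add: word_binomial_eq_card_occurrences occurrences_Nil_right)

lemma word_binomial_Nil_left: "word_binomial [] x = of_bool (x = [])"
  by (cases x) (auto simp: word_binomial_def)

lemma word_binomial_snoc:
  "word_binomial (u @ [b]) (x @ [a])
    = word_binomial u (x @ [a]) + of_bool (a = b) * word_binomial u x"
proof -
  have "length u \<notin> I" if "I \<in> occurrences u x" for I
    using that by (auto simp: occurrences_def)
  then have "inj_on (insert (length u)) (occurrences u x)"
    by (intro inj_onI) (metis insert_ident)
  moreover have "occurrences u (x @ [a]) \<inter> insert (length u) ` occurrences u x = {}"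
    by (auto simp: occurrences_def)
  ultimately show ?thesis
    by (auto simp: word_binomial_eq_card_occurrences occurrences_snoc finite_occurrences
        card_Un_disjoint card_image)
qed

lemma word_binomial_append:
  "word_binomial (u @ v) x = (\<Sum>i\<le>length x. word_binomial u (take i x) * word_binomial v (drop i x))"
proof (induction v arbitrary: x rule: rev_induct)
  case Nil
  have "(\<Sum>i\<le>length x. word_binomial u (take i x) * word_binomial [] (drop i x))
      = (\<Sum>i\<in>{length x}. word_binomial u (take i x) * word_binomial [] (drop i x))"
    by (rule sum.mono_neutral_right) (auto simp: word_binomial_Nil_left)
  then show ?case by simp
next
  case (snoc b v)
  show ?case
  proof (cases x rule: rev_cases)
    case Nil
    then show ?thesis by simp
  next
    case (snoc y a)
    have "word_binomial (u @ v @ [b]) x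
        = word_binomial (u @ v) x + of_bool (a = b) * word_binomial (u @ v) y"
      using word_binomial_snoc[of "u @ v" b y a] snoc by simp
    also have "\<dots> = (\<Sum>i\<le>length x. word_binomial u (take i x) * word_binomial v (drop i x))
        + of_bool (a = b) * (\<Sum>i\<le>length y. word_binomial u (take i y) * word_binomial v (drop i y))"
      by (simp only: snoc.IH)
    also have "\<dots> = (\<Sum>i\<le>length x. word_binomial u (take i x) * word_binomial (v @ [b]) (drop i x))"
      by (simp add: snoc word_binomial_snoc algebra_simps sum.distrib sum_distrib_left)
    finally show ?thesis .
  qed
qed

lemma sum_word_binomial:
  assumes "finite A" "set u \<subseteq> A"
  shows "(\<Sum>x | set x \<subseteq> A \<and> length x = j. word_binomial u x) = length u choose j"
proof -
  let ?X = "{x. set x \<subseteq> A \<and> length x = j}"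
  have "(\<Sum>x\<in>?X. word_binomial u x) = card (\<Union>x\<in>?X. occurrences u x)"
    unfolding word_binomial_eq_card_occurrences using assms(1)
    by (intro card_UN_disjoint[symmetric] finite_lists_length_eq ballI finite_occurrences)
      (auto simp: occurrences_def)
  also have "(\<Union>x\<in>?X. occurrences u x) = {I. I \<subseteq> {..<length u} \<and> card I = j}"
    using assms(2) set_nths_subset[of u] by (fastforce simp: occurrences_def length_nths_subset)
  also have "card \<dots> = length u choose j"
    by (simp add: n_subsets)
  finally show ?thesis .
qed

lemma sum_word_binomial_snoc:
  fixes f :: "'a \<Rightarrow> 'b::comm_semiring_1"
  assumes "finite A" "set u \<subseteq> A"
  shows "(\<Sum>x | set x \<subseteq> A \<and> length x = j. \<Sum>a\<in>A. of_nat (word_binomial u (x @ [a])) * f a)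
       = (\<Sum>i<length u. of_nat (i choose j) * f (u ! i))"
  using assms(2)
proof (induction u rule: rev_induct)
  case Nil
  show ?case by (simp add: word_binomial_Nil_left)
next
  case (snoc b u)
  let ?X = "{x. set x \<subseteq> A \<and> length x = j}"
  have last_letter: "(\<Sum>a\<in>A. of_bool (a = b) * f a) = f b"
  proof -
    have "(\<Sum>a\<in>A. of_bool (a = b) * f a) = (\<Sum>a\<in>A. if a = b then f a else 0)"
      by (intro sum.cong) auto
    then show ?thesis using assms(1) snoc.prems by simp
  qed
  have "(\<Sum>x\<in>?X. \<Sum>a\<in>A. of_nat (word_binomial (u @ [b]) (x @ [a])) * f a)
      = (\<Sum>x\<in>?X. \<Sum>a\<in>A. of_nat (word_binomial u (x @ [a])) * f a)
        + (\<Sum>x\<in>?X. of_nat (word_binomial u x) * (\<Sum>a\<in>A. of_bool (a = b) * f a))"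
    by (simp add: word_binomial_snoc algebra_simps sum.distrib sum_distrib_left)
  also have "\<dots> = (\<Sum>i<length u. of_nat (i choose j) * f (u ! i)) + of_nat (length u choose j) * f b"
    using snoc sum_word_binomial[OF assms(1), of u j]
    by (simp add: last_letter flip: sum_distrib_right of_nat_sum)
  also have "\<dots> = (\<Sum>i<length (u @ [b]). of_nat (i choose j) * f ((u @ [b]) ! i))"
    by (simp add: nth_append)
  finally show ?case .
qed

section \<open>Binomial equivalence\<close>

lemma binomially_equivalent_refl: "binomially_equivalent k u u"
  by (simp add: binomially_equivalent_def)

lemma binomially_equivalent_sym: "binomially_equivalent k u v \<Longrightarrow> binomially_equivalent k v u"
  by (simp add: binomially_equivalent_def)

lemma binomially_equivalent_trans [trans]:
  "binomially_equivalent k u v \<Longrightarrow> binomially_equivalent k v w \<Longrightarrow> binomially_equivalent k u w"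
  by (simp add: binomially_equivalent_def)

lemma binomially_equivalent_0: "binomially_equivalent 0 u v"
  by (simp add: binomially_equivalent_def)

lemma binomially_equivalent_append:
  assumes "binomially_equivalent k u u'" "binomially_equivalent k v v'"
  shows "binomially_equivalent k (u @ v) (u' @ v')"
  using assms unfolding binomially_equivalent_def word_binomial_append
  by (intro allI impI sum.cong refl) simp

lemma binomially_equivalent_length:
  assumes "binomially_equivalent k u v" "k \<ge> 1"
  shows "length u = length v"
proof -
  let ?A = "set u \<union> set v"
  have "length u = (\<Sum>x | set x \<subseteq> ?A \<and> length x = 1. word_binomial u x)"
    by (subst sum_word_binomial) auto
  also have "\<dots> = (\<Sum>x | set x \<subseteq> ?A \<and> length x = 1. word_binomial v x)"
    using assms by (intro sum.cong) (auto simp: binomially_equivalent_def)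
  also have "\<dots> = length v"
    by (subst sum_word_binomial) auto
  finally show ?thesis .
qed

lemma binomially_equivalent_append_commute:
  assumes "binomially_equivalent k u v"
  shows "binomially_equivalent (Suc k) (u @ v) (v @ u)"
  unfolding binomially_equivalent_def
proof (intro allI impI)
  fix x :: "'a list" assume length_x: "length x \<le> Suc k"
  show "word_binomial (u @ v) x = word_binomial (v @ u) x"
  proof (cases "x = []")
    case False
    have split_ends: "(\<Sum>i\<le>length x. g i) = g 0 + g (length x) + (\<Sum>i\<in>{1..<length x}. g i)"
      for g :: "nat \<Rightarrow> nat"
    proof -
      have "{..length x} = insert 0 (insert (length x) {1..<length x})"
        using False by (auto simp: Suc_le_eq)
      then show ?thesis using False by simp
    qed
    have "word_binomial u (take i x) * word_binomial v (drop i x)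
        = word_binomial v (take i x) * word_binomial u (drop i x)" if "i \<in> {1..<length x}" for i
    proof -
      have "length (take i x) \<le> k" "length (drop i x) \<le> k" using that length_x by auto
      then show ?thesis using assms by (simp only: binomially_equivalent_def)
    qed
    then show ?thesis by (simp add: word_binomial_append split_ends)
  qed simp
qed

lemma binomially_equivalent_append_concat_commute:
  assumes "\<And>v. v \<in> set vs \<Longrightarrow> binomially_equivalent k u v"
  shows "binomially_equivalent (Suc k) (u @ concat vs) (concat vs @ u)"
  using assms
proof (induction vs)
  case Nil
  show ?case by (simp add: binomially_equivalent_refl)
next
  case (Cons v vs)
  have "binomially_equivalent (Suc k) ((u @ v) @ concat vs) ((v @ u) @ concat vs)"
    using Cons.prems
    by (intro binomially_equivalent_append binomially_equivalent_append_commute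
        binomially_equivalent_refl) simp
  also have "binomially_equivalent (Suc k) ((v @ u) @ concat vs) (v @ concat vs @ u)"
    using Cons by (auto intro!: binomially_equivalent_append binomially_equivalent_refl)
  finally show ?case by simp
qed

lemma binomially_equivalent_concat_rotate:
  assumes "\<And>u v. u \<in> set ws \<Longrightarrow> v \<in> set ws \<Longrightarrow> binomially_equivalent k u v"
  shows "binomially_equivalent (Suc k) (concat (rotate n ws)) (concat ws)"
proof (induction n)
  case 0
  show ?case by (simp add: binomially_equivalent_refl)
next
  case (Suc n)
  have "binomially_equivalent (Suc k) (concat (rotate1 vs)) (concat vs)" if "set vs = set ws" for vs
  proof (cases vs)
    case Nil
    then show ?thesis by (simp add: binomially_equivalent_refl)
  next
    case (Cons v vs')
    then have "binomially_equivalent (Suc k) (v @ concat vs') (concat vs' @ v)"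
      using assms that by (intro binomially_equivalent_append_concat_commute) auto
    then show ?thesis using Cons by (simp add: binomially_equivalent_sym)
  qed
  from this[of "rotate n ws"] Suc show ?case
    by (auto intro: binomially_equivalent_trans)
qed

section \<open>The generalized Thue--Morse word\<close>

lemma sigma_singleton: "sigma m [a] = rotate a [0..<m]"
  by (rule nth_equalityI) (simp_all add: sigma_def nth_rotate)

lemma sigma_Cons: "sigma m (c # w) = map (\<lambda>r. (c + r) mod m) [0..<m] @ sigma m w"
  by (simp add: sigma_def)

lemma funpow_sigma_concat: "(sigma m ^^ j) w = concat (map (\<lambda>c. (sigma m ^^ j) [c]) w)"
proof (induction w)
  case Nil
  show ?case by (induction j) (simp_all add: sigma_def)
next
  case (Cons c w)
  then show ?case using funpow_sigma_append[of j m "[c]" w] by simp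
qed

lemma hd_funpow_sigma:
  assumes "c < m"
  shows "hd ((sigma m ^^ j) (c # w)) = c"
proof (induction j)
  case (Suc j)
  have "(sigma m ^^ j) (c # w) \<noteq> []"
    using assms length_funpow_sigma[of j m "c # w"] by fastforce
  then obtain w' where "(sigma m ^^ j) (c # w) = c # w'"
    using Suc by (cases "(sigma m ^^ j) (c # w)") auto
  then show ?case using assms by (simp add: sigma_Cons upt_conv_Cons)
qed simp

lemma binomially_equivalent_funpow_sigma:
  "binomially_equivalent k ((sigma m ^^ k) [a]) ((sigma m ^^ k) [b])"
proof (induction k arbitrary: a b)
  case 0
  show ?case by (rule binomially_equivalent_0)
next
  case (Suc k)
  let ?blocks = "map (\<lambda>c. (sigma m ^^ k) [c]) [0..<m]"
  have rotated: "(sigma m ^^ Suc k) [c] = concat (rotate c ?blocks)" for c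
    using funpow_sigma_concat[of k m "sigma m [c]"]
    by (simp only: funpow_Suc_right comp_apply sigma_singleton rotate_map)
  have "binomially_equivalent (Suc k) (concat (rotate c ?blocks)) (concat ?blocks)" for c
    by (rule binomially_equivalent_concat_rotate) (auto intro: Suc.IH)
  then show ?case
    unfolding rotated by (blast intro: binomially_equivalent_trans binomially_equivalent_sym)
qed

lemma map_upt_in_factors: "map x [i..<i + n] \<in> factors x"
  by (auto simp: factors_def)

lemma nth_sigma:
  assumes "q < length w" "r < m"
  shows "sigma m w ! (m * q + r) = (w ! q + r) mod m"
  using assms(1)
proof (induction w arbitrary: q)
  case (Cons c w)
  show ?case
  proof (cases q)
    case 0
    then show ?thesis using assms(2) by (simp add: sigma_Cons nth_append)
  next
    case (Suc p)
    then show ?thesis using Cons.IH[of p] Cons.prems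
      by (simp add: sigma_Cons nth_append add.assoc)
  qed
qed simp

lemma thue_morse_0:
  assumes "m \<ge> 2"
  shows "thue_morse m 0 = 0"
proof -
  have "\<forall>\<^sub>F j in sequentially. thue_morse m 0 = 0"
    using eventually_thue_morse[OF assms, of 0]
  proof eventually_elim
    case (elim j)
    have "prefix [0] ((sigma m ^^ j) [0])"
      using prefix_funpow_sigma[of m 0 j] assms by simp
    then show ?case using elim by (auto simp: prefix_def)
  qed
  then show ?thesis by simp
qed

lemma thue_morse_mult_add:
  assumes "m \<ge> 2" "r < m"
  shows "thue_morse m (m * q + r) = (thue_morse m q + r) mod m"
proof -
  have "\<forall>\<^sub>F j in sequentially. m * q + r < length ((sigma m ^^ Suc j) [0]) \<and>
      (sigma m ^^ Suc j) [0] ! (m * q + r) = thue_morse m (m * q + r)"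
    using eventually_thue_morse[OF assms(1), of "m * q + r"]
    by (rule eventually_sequentially_Suc[THEN iffD2])
  then have "\<forall>\<^sub>F j in sequentially. thue_morse m (m * q + r) = (thue_morse m q + r) mod m"
    using eventually_thue_morse[OF assms(1), of q]
    by eventually_elim (use assms(2) in \<open>simp add: nth_sigma\<close>)
  then show ?thesis by simp
qed

lemma thue_morse_div:
  assumes "m \<ge> 2"
  shows "thue_morse m i = (thue_morse m (i div m) + i) mod m"
  using thue_morse_mult_add[OF assms, of "i mod m" "i div m"] assms by (simp add: mod_add_right_eq)

lemma thue_morse_less:
  assumes "m \<ge> 2"
  shows "thue_morse m i < m"
  using assms by (subst thue_morse_div) simp_all

lemma sigma_map_thue_morse:
  assumes "m \<ge> 2"
  shows "sigma m (map (thue_morse m) [i..<i + n]) = map (thue_morse m) [m * i..<m * i + m * n]"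
proof (induction n)
  case (Suc n)
  have "sigma m [thue_morse m (i + n)] = map (thue_morse m) [m * (i + n)..<m * (i + n) + m]"
    by (rule nth_equalityI) (simp_all add: sigma_def thue_morse_mult_add[OF assms])
  then show ?case
    using Suc upt_add_eq_append[of "m * i" "m * i + m * n" m]
    by (simp add: sigma_append algebra_simps)
qed (simp add: sigma_def)

lemma funpow_sigma_in_factors:
  assumes "m \<ge> 2" "w \<in> factors (thue_morse m)"
  shows "(sigma m ^^ k) w \<in> factors (thue_morse m)"
proof (induction k)
  case 0
  then show ?case using assms(2) by simp
next
  case (Suc k)
  then obtain i n where "(sigma m ^^ k) w = map (thue_morse m) [i..<i + n]"
    by (auto simp: factors_def)
  then show ?case
    using sigma_map_thue_morse[OF assms(1), of i n]
    by (simp only: funpow.simps comp_apply map_upt_in_factors)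
qed

text \<open>If \<open>(c + 1) 0\<close> is a factor, then \<open>\<sigma>(c + 1) \<sigma>(0)\<close> contains \<open>c 0\<close> at the block boundary.\<close>

lemma ex_thue_morse_descent_to_0:
  assumes "m \<ge> 2" "1 \<le> c" "c \<le> m - 1"
  shows "\<exists>i. thue_morse m i = c \<and> thue_morse m (Suc i) = 0"
  using assms(3,2)
proof (induction c rule: inc_induct)
  case base
  have "thue_morse m 1 = 1"
    using thue_morse_mult_add[of m 1 0] thue_morse_0[OF assms(1)] assms(1) by simp
  moreover have "Suc (m * 1 + (m - 2)) = m * 1 + (m - 1)"
    using assms(1) by simp
  ultimately have "thue_morse m (m * 1 + (m - 2)) = m - 1"
    "thue_morse m (Suc (m * 1 + (m - 2))) = 0"
    using assms(1) by (simp_all only: thue_morse_mult_add) simp_all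
  then show ?case by blast
next
  case (step c)
  then obtain i where i: "thue_morse m i = Suc c" "thue_morse m (Suc i) = 0"
    by auto
  have "thue_morse m (m * i + (m - 1)) = c"
    using thue_morse_mult_add[of m "m - 1" i] i(1) step.hyps assms(1) by simp
  moreover have "thue_morse m (Suc (m * i + (m - 1))) = 0"
  proof -
    have "Suc (m * i + (m - 1)) = m * Suc i + 0" using assms(1) by simp
    then show ?thesis
      using assms(1) i(2) by (simp only: thue_morse_mult_add) simp
  qed
  ultimately show ?case by blast
qed

lemma thue_morse_01_10_in_factors:
  assumes "m \<ge> 2"
  shows "[0, 1] \<in> factors (thue_morse m)" "[1, 0] \<in> factors (thue_morse m)"
proof -
  have pair_in_factors: "[thue_morse m i, thue_morse m (Suc i)] \<in> factors (thue_morse m)" for i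
    using map_upt_in_factors[of "thue_morse m" i 2] by (simp add: upt_rec numeral_2_eq_2)
  have "thue_morse m (Suc 0) = 1"
    using thue_morse_mult_add[of m 1 0] thue_morse_0[OF assms] assms by simp
  then show "[0, 1] \<in> factors (thue_morse m)"
    using pair_in_factors[of 0] thue_morse_0[OF assms] by simp
  obtain i where "thue_morse m i = 1" "thue_morse m (Suc i) = 0"
    using ex_thue_morse_descent_to_0[OF assms order_refl] assms by fastforce
  then show "[1, 0] \<in> factors (thue_morse m)"
    using pair_in_factors[of i] by simp
qed

lemma ex_binomially_equivalent_factors:
  assumes "m \<ge> 2"
  shows "\<exists>u \<in> factors (thue_morse m). \<exists>v \<in> factors (thue_morse m).
     u \<noteq> v \<and> binomially_equivalent (Suc k) u v \<and> length u = 2 * m ^ k \<and> length v = 2 * m ^ k"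
proof (intro bexI conjI)
  let ?s = "sigma m ^^ k"
  have "hd (?s [0, 1]) = 0" "hd (?s [1, 0]) = 1"
    using assms by (simp_all add: hd_funpow_sigma)
  then show "?s [0, 1] \<noteq> ?s [1, 0]"
    by (metis zero_neq_one)
  have "?s [a, b] = ?s [a] @ ?s [b]" for a b
    using funpow_sigma_append[of k m "[a]" "[b]"] by simp
  then show "binomially_equivalent (Suc k) (?s [0, 1]) (?s [1, 0])"
    by (simp add: binomially_equivalent_append_commute binomially_equivalent_funpow_sigma)
  show "length (?s [0, 1]) = 2 * m ^ k" "length (?s [1, 0]) = 2 * m ^ k"
    by (simp_all add: length_funpow_sigma)
  show "?s [0, 1] \<in> factors (thue_morse m)" "?s [1, 0] \<in> factors (thue_morse m)"
    using assms by (simp_all only: funpow_sigma_in_factors thue_morse_01_10_in_factors)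
qed

section \<open>Moments\<close>

definition moments_agree :: "nat \<Rightarrow> nat \<Rightarrow> (nat \<Rightarrow> 'a) \<Rightarrow> (nat \<Rightarrow> 'a) \<Rightarrow> bool" where
  "moments_agree k n u v \<longleftrightarrow>
     (\<forall>(p :: real poly) (f :: 'a \<Rightarrow> real). degree p < k \<longrightarrow>
        (\<Sum>i<n. poly p (real i) * f (u i)) = (\<Sum>i<n. poly p (real i) * f (v i)))"

lemma moments_agreeD:
  "moments_agree k n u v \<Longrightarrow> degree p < k \<Longrightarrow>
     (\<Sum>i<n. poly p (real i) * f (u i)) = (\<Sum>i<n. poly p (real i) * f (v i))"
  by (simp add: moments_agree_def)

lemma moments_agree_sym: "moments_agree k n u v \<Longrightarrow> moments_agree k n v u"
  by (simp add: moments_agree_def)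

lemma moments_agree_mono: "moments_agree k n u v \<Longrightarrow> j \<le> k \<Longrightarrow> moments_agree j n u v"
  by (auto simp: moments_agree_def)

lemma binomial_mult_poly_pCons:
  "real (i choose j) * poly (pCons c p) (real i)
    = c * real (i choose j) + real j * (real (i choose j) * poly p (real i))
      + real (Suc j) * (real (i choose Suc j) * poly p (real i))"
proof -
  have absorb: "real (i choose j) * real i
      = real j * real (i choose j) + real (Suc j) * real (i choose Suc j)"
    unfolding binomial_gbinomial by (rule gbinomial_mult_1')
  have "real (i choose j) * poly (pCons c p) (real i)
      = c * real (i choose j) + (real (i choose j) * real i) * poly p (real i)"
    by (simp add: algebra_simps)
  then show ?thesis
    unfolding absorb by (simp only: distrib_right mult.assoc add.assoc)
qed

lemma moments_agree_if_binomial_moments_agree: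
  fixes u v :: "nat \<Rightarrow> 'a"
  assumes "\<And>j (f :: 'a \<Rightarrow> real). j < k \<Longrightarrow>
    (\<Sum>i<n. real (i choose j) * f (u i)) = (\<Sum>i<n. real (i choose j) * f (v i))"
  shows "moments_agree k n u v"
proof -
  have "(\<Sum>i<n. real (i choose j) * poly p (real i) * f (u i))
      = (\<Sum>i<n. real (i choose j) * poly p (real i) * f (v i))"
    if "j + degree p < k" for j p and f :: "'a \<Rightarrow> real"
    using that
  proof (induction p arbitrary: j)
    case 0
    show ?case by simp
  next
    case (pCons c p)
    show ?case
    proof (cases "p = 0")
      case True
      then show ?thesis
        using assms[of j "\<lambda>x. c * f x"] pCons.prems by (simp add: mult.assoc)
    next
      case False
      have "(\<Sum>i<n. real (i choose j) * poly (pCons c p) (real i) * f (w i))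
          = c * (\<Sum>i<n. real (i choose j) * f (w i))
            + real j * (\<Sum>i<n. real (i choose j) * poly p (real i) * f (w i))
            + real (Suc j) * (\<Sum>i<n. real (i choose Suc j) * poly p (real i) * f (w i))" for w
        unfolding binomial_mult_poly_pCons
        by (simp only: distrib_right sum.distrib sum_distrib_left mult.assoc)
      moreover have "j < k" "j + degree p < k" "Suc j + degree p < k"
        using pCons.prems False by simp_all
      ultimately show ?thesis
        by (simp only: assms[of j] pCons.IH)
    qed
  qed
  from this[of 0] show ?thesis by (simp add: moments_agree_def)
qed

lemma binomially_equivalent_imp_moments_agree:
  assumes "binomially_equivalent k u v" "length u = length v"
  shows "moments_agree k (length u) ((!) u) ((!) v)"
proof (rule moments_agree_if_binomial_moments_agree)
  fix j and f :: "'a \<Rightarrow> real" assume "j < k"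
  let ?A = "set u \<union> set v"
  have "(\<Sum>i<length u. real (i choose j) * f (u ! i))
      = (\<Sum>x | set x \<subseteq> ?A \<and> length x = j. \<Sum>a\<in>?A. real (word_binomial u (x @ [a])) * f a)"
    by (rule sum_word_binomial_snoc[symmetric]) auto
  also have "\<dots> = (\<Sum>x | set x \<subseteq> ?A \<and> length x = j. \<Sum>a\<in>?A. real (word_binomial v (x @ [a])) * f a)"
    using assms(1) \<open>j < k\<close> by (intro sum.cong) (auto simp: binomially_equivalent_def)
  also have "\<dots> = (\<Sum>i<length u. real (i choose j) * f (v ! i))"
    unfolding assms(2) by (rule sum_word_binomial_snoc) auto
  finally show "(\<Sum>i<length u. real (i choose j) * f (u ! i))
      = (\<Sum>i<length u. real (i choose j) * f (v ! i))" .
qed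

lemma moments_agree_translate:
  assumes "moments_agree k n u v" "degree p < k"
  shows "(\<Sum>i<n. poly p (real i + c) * f (u i)) = (\<Sum>i<n. poly p (real i + c) * f (v i))"
  using moments_agreeD[OF assms(1), of "pcompose p [:c, 1:]" f] assms(2)
  by (simp add: poly_pcompose degree_pcompose add.commute)

lemma moments_agree_window:
  assumes "moments_agree k n u v" "a + l \<le> n"
    and "\<And>i. i < n \<Longrightarrow> i < a \<or> a + l \<le> i \<Longrightarrow> u i = v i"
  shows "moments_agree k l (\<lambda>i. u (a + i)) (\<lambda>i. v (a + i))"
  unfolding moments_agree_def
proof (intro allI impI)
  fix p :: "real poly" and f :: "'a \<Rightarrow> real" assume "degree p < k"
  let ?g = "\<lambda>w i. poly p (real i + - real a) * f (w i)"
  have window: "(\<Sum>i<l. poly p (real i) * f (w (a + i)))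
      = (\<Sum>i<n. ?g w i) - (\<Sum>i\<in>{..<n} - {a..<a + l}. ?g w i)" for w
  proof -
    have "(\<Sum>i<l. poly p (real i) * f (w (a + i))) = (\<Sum>i\<in>{a..<a + l}. ?g w i)"
      by (rule sum.reindex_bij_witness[of _ "\<lambda>i. i - a" "\<lambda>i. a + i"]) auto
    moreover have "{a..<a + l} \<subseteq> {..<n}" using assms(2) by auto
    ultimately show ?thesis
      by (simp add: sum.subset_diff[of "{a..<a + l}" "{..<n}"])
  qed
  have "(\<Sum>i\<in>{..<n} - {a..<a + l}. ?g u i) = (\<Sum>i\<in>{..<n} - {a..<a + l}. ?g v i)"
    using assms(3) by (intro sum.cong) auto
  then show "(\<Sum>i<l. poly p (real i) * f (u (a + i))) = (\<Sum>i<l. poly p (real i) * f (v (a + i)))"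
    unfolding window using moments_agree_translate[OF assms(1) \<open>degree p < k\<close>, of "- real a" f]
    by simp
qed

lemma moments_agree_trim:
  assumes "moments_agree k n u v" "i < n" "u i \<noteq> v i"
  obtains a l where "a + Suc l \<le> n" "moments_agree k (Suc l) (\<lambda>i. u (a + i)) (\<lambda>i. v (a + i))"
    "u a \<noteq> v a" "u (a + l) \<noteq> v (a + l)"
proof -
  define D where "D = {i. i < n \<and> u i \<noteq> v i}"
  have D_finite: "finite D" and D_nonempty: "D \<noteq> {}"
    using assms(2,3) by (auto simp: D_def)
  define a where "a = Min D"
  define l where "l = Max D - a"
  have "a \<le> Max D" using D_finite D_nonempty by (simp add: a_def)
  then have a_plus_l: "a + l = Max D" by (simp add: l_def)
  have ends: "a \<in> D" "a + l \<in> D"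
    unfolding a_plus_l using D_finite D_nonempty by (simp_all add: a_def)
  have "u i = v i" if "i < n" "i < a \<or> a + Suc l \<le> i" for i
  proof -
    have "i < Min D \<or> Max D < i" using that(2) a_plus_l by (auto simp: a_def)
    then have "i \<notin> D" using Min_le[OF D_finite, of i] Max_ge[OF D_finite, of i] by linarith
    then show ?thesis using that(1) by (simp add: D_def)
  qed
  with ends show ?thesis
    by (intro that moments_agree_window[OF assms(1)]) (auto simp: D_def)
qed

lemma moments_agree_length_1:
  assumes "moments_agree (Suc k) 1 u v"
  shows "u 0 = v 0"
  using moments_agreeD[OF assms, of 1 "\<lambda>x. of_bool (x = u 0)"] by (simp split: if_splits)

section \<open>Words cut into cycles\<close>

text \<open>\<open>increment_sum\<close> telescopes along every stretch of \<open>u\<close> on which the next letter is obtained by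
  applying \<open>s\<close>.\<close>

definition increment_sum :: "real poly \<Rightarrow> ('a \<Rightarrow> 'a) \<Rightarrow> ('a \<Rightarrow> real) \<Rightarrow> (nat \<Rightarrow> 'a) \<Rightarrow> nat \<Rightarrow> real" where
  "increment_sum p s f u n =
     (\<Sum>i<n. poly p (real i + 1) * f (s (u i)) - poly p (real i) * f (u i))"

lemma moments_agree_increment_sum:
  assumes "moments_agree k n u v" "degree p < k"
  shows "increment_sum p s f u n = increment_sum p s f v n"
  using moments_agreeD[OF assms, of f] moments_agree_translate[OF assms, of 1 "\<lambda>x. f (s x)"]
  by (simp add: increment_sum_def sum_subtractf)

text \<open>The word \<open>u\<close> is cut out of a concatenation of blocks \<open>b, s b, s (s b), \<dots>\<close>, each of which
  runs through a cycle of \<open>s\<close>, and \<open>h i\<close> is the first letter of the block that covers position \<open>i\<close>.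
  This first letter may lie outside of \<open>u\<close>.\<close>

definition cut_into_cycles :: "('a \<Rightarrow> 'a) \<Rightarrow> (nat \<Rightarrow> 'a) \<Rightarrow> nat \<Rightarrow> (nat \<Rightarrow> 'a) \<Rightarrow> bool" where
  "cut_into_cycles s h n u \<longleftrightarrow>
     (\<forall>i. Suc i < n \<longrightarrow>
        u (Suc i) = s (u i) \<and> h (Suc i) = h i \<or> s (u i) = h i \<and> u (Suc i) = h (Suc i))"

lemma cut_into_cycles_cases:
  assumes "cut_into_cycles s h n u" "Suc i < n"
  obtains (inside) "u (Suc i) = s (u i)" "h (Suc i) = h i"
    | (boundary) "s (u i) = h i" "u (Suc i) = h (Suc i)"
  using assms unfolding cut_into_cycles_def by blast

lemma cut_into_cycles_Suc: "cut_into_cycles s h (Suc n) u \<Longrightarrow> cut_into_cycles s h n u"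
  by (simp add: cut_into_cycles_def)

lemma increment_sum_const_cut_into_cycles:
  assumes "cut_into_cycles s h (Suc n) u"
  shows "increment_sum 1 s f u (Suc n) = f (s (u n)) - f (h n) + f (h 0) - f (u 0)"
  using assms
proof (induction n)
  case 0
  show ?case by (simp add: increment_sum_def)
next
  case (Suc n)
  have "f (s (u n)) - f (h n) = f (u (Suc n)) - f (h (Suc n))"
    using Suc.prems lessI by (cases rule: cut_into_cycles_cases) simp_all
  then show ?case
    using Suc.IH[OF cut_into_cycles_Suc[OF Suc.prems]] by (simp add: increment_sum_def)
qed

text \<open>By summation by parts, only the right end of \<open>u\<close> and the block boundaries contribute; a
  boundary at position \<open>i\<close> contributes \<open>i ([h (i - 1) = c] - [h i = c])\<close>.\<close>

lemma increment_sum_linear_cut_into_cycles_bounds: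
  assumes "cut_into_cycles s h (Suc n) u"
  shows "increment_sum [:0, 1:] s (\<lambda>x. of_bool (x = c)) u (Suc n)
    \<in> {(real n + 1) * of_bool (s (u n) = c) - real n * of_bool (h n = c)
       .. (real n + 1) * of_bool (s (u n) = c) + real n * of_bool (h n \<noteq> c)}"
  using assms
proof (induction n)
  case 0
  show ?case by (simp add: increment_sum_def)
next
  case (Suc n)
  let ?S = "increment_sum [:0, 1:] s (\<lambda>x. of_bool (x = c)) u"
  have "?S (Suc (Suc n)) = ?S (Suc n)
      + (real n + 2) * of_bool (s (u (Suc n)) = c) - (real n + 1) * of_bool (u (Suc n) = c)"
    by (simp add: increment_sum_def)
  with Suc.prems lessI show ?case
    using Suc.IH[OF cut_into_cycles_Suc[OF Suc.prems]]
    by (cases rule: cut_into_cycles_cases) (auto simp: of_bool_def algebra_simps split: if_splits)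
qed

lemma cut_into_cycles_right_end:
  assumes "cut_into_cycles s h (Suc n) u" "cut_into_cycles s h' (Suc n) v"
    and "moments_agree 2 (Suc n) u v" "s (u n) \<noteq> s (v n)"
  shows "s (v n) = h' n"
proof (rule ccontr)
  assume "s (v n) \<noteq> h' n"
  let ?S = "\<lambda>w. increment_sum [:0, 1:] s (\<lambda>x. of_bool (x = s (v n))) w (Suc n)"
  have "?S u \<le> real n * of_bool (h n \<noteq> s (v n))"
    using increment_sum_linear_cut_into_cycles_bounds[OF assms(1), of "s (v n)"] assms(4) by simp
  also have "\<dots> < real n + 1" by simp
  also have "\<dots> \<le> ?S v"
    using increment_sum_linear_cut_into_cycles_bounds[OF assms(2), of "s (v n)"]
      \<open>s (v n) \<noteq> h' n\<close> by simp
  also have "\<dots> = ?S u"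
    using assms(3) by (intro moments_agree_increment_sum[symmetric]) auto
  finally show False by simp
qed

lemma cut_into_cycles_left_end:
  assumes "cut_into_cycles s h (Suc n) u" "cut_into_cycles s h' (Suc n) v"
    and "moments_agree 1 (Suc n) u v" "s (u n) = h n" "s (v n) = h' n" "u 0 \<noteq> v 0"
  shows "u 0 = h 0"
proof (rule ccontr)
  assume "u 0 \<noteq> h 0"
  let ?f = "\<lambda>x. of_bool (x = u 0) :: real"
  have "?f (h 0) - ?f (u 0) = increment_sum 1 s ?f u (Suc n)"
    using assms(4) by (simp add: increment_sum_const_cut_into_cycles[OF assms(1)])
  also have "\<dots> = increment_sum 1 s ?f v (Suc n)"
    by (rule moments_agree_increment_sum[OF assms(3)]) simp
  also have "\<dots> = ?f (h' 0) - ?f (v 0)"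
    using assms(5) by (simp add: increment_sum_const_cut_into_cycles[OF assms(2)])
  finally show False
    using \<open>u 0 \<noteq> h 0\<close> assms(6) by (simp add: of_bool_def split: if_splits)
qed

lemma cut_into_cycles_ends:
  assumes "cut_into_cycles s h (Suc n) u" "cut_into_cycles s h' (Suc n) v"
    and "moments_agree 2 (Suc n) u v" "u 0 \<noteq> v 0" "s (u n) \<noteq> s (v n)"
  shows "u 0 = h 0" "s (u n) = h n"
proof -
  show right_end: "s (u n) = h n"
    using assms(5)
    by (intro cut_into_cycles_right_end[OF assms(2,1)] moments_agree_sym[OF assms(3)]) simp
  show "u 0 = h 0"
    using right_end cut_into_cycles_right_end[OF assms(1-3,5)] assms(4)
    by (intro cut_into_cycles_left_end[OF assms(1,2)] moments_agree_mono[OF assms(3)]) simp_all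
qed

section \<open>Desubstitution\<close>

lemma ex_poly_eq_gbinomial:
  "\<exists>p :: 'a::field_char_0 poly. degree p \<le> j \<and> (\<forall>x. poly p x = x gchoose j)"
proof (intro exI conjI allI)
  let ?p = "smult (inverse (fact j)) (\<Prod>i<j. [:- of_nat i, 1:]) :: 'a poly"
  have "degree (\<Prod>i<j. [:- of_nat i, 1:] :: 'a poly) \<le> (\<Sum>i<j. degree [:- of_nat i, 1:: 'a:])"
    using degree_prod_sum_le[of "{..<j}" "\<lambda>i. [:- of_nat i, 1:: 'a:]"] by (simp add: comp_def)
  then show "degree ?p \<le> j" by simp
  show "poly ?p x = x gchoose j" for x
    by (simp add: poly_prod gbinomial_prod_rev lessThan_atLeast0 field_simps)
qed

definition concat_of_cycles ::
  "('a \<Rightarrow> 'a) \<Rightarrow> nat \<Rightarrow> nat \<Rightarrow> (nat \<Rightarrow> 'a) \<Rightarrow> (nat \<Rightarrow> 'a) \<Rightarrow> bool" where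
  "concat_of_cycles s m l w u \<longleftrightarrow>
     (\<forall>q<l. (s ^^ m) (w q) = w q \<and> (\<forall>r<m. u (q * m + r) = (s ^^ r) (w q)))"

lemma increment_sum_concat_of_cycles:
  assumes "concat_of_cycles s m l w u"
  shows "increment_sum p s f u (l * m)
    = (\<Sum>q<l. (poly p (real (Suc q * m)) - poly p (real (q * m))) * f (w q))"
proof -
  let ?d = "\<lambda>i. poly p (real i + 1) * f (s (u i)) - poly p (real i) * f (u i)"
  have "sum ?d {q * m..<q * m + m} = (poly p (real (Suc q * m)) - poly p (real (q * m))) * f (w q)"
    if "q < l" for q
  proof -
    let ?g = "\<lambda>i. poly p (real i) * f ((s ^^ (i - q * m)) (w q))"
    have "sum ?d {q * m..<q * m + m} = (\<Sum>i = q * m..<q * m + m. ?g (Suc i) - ?g i)"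
    proof (rule sum.cong)
      fix i assume "i \<in> {q * m..<q * m + m}"
      then have "i - q * m < m" "q * m + (i - q * m) = i" "Suc i - q * m = Suc (i - q * m)"
        by auto
      moreover from this have "u i = (s ^^ (i - q * m)) (w q)"
        using assms that unfolding concat_of_cycles_def by metis
      ultimately show "?d i = ?g (Suc i) - ?g i" by (simp add: add.commute)
    qed simp
    also have "\<dots> = ?g (q * m + m) - ?g (q * m)"
      by (rule sum_Suc_diff') simp
    also have "\<dots> = (poly p (real (Suc q * m)) - poly p (real (q * m))) * f (w q)"
      using assms that by (simp add: concat_of_cycles_def left_diff_distrib add.commute)
    finally show ?thesis .
  qed
  then show ?thesis
    unfolding increment_sum_def sum.nat_group[symmetric] by (intro sum.cong) auto
qed

lemma moments_agree_desubstitute: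
  assumes "m > 0" "moments_agree (Suc k) (l * m) u v"
    and "concat_of_cycles s m l w u" "concat_of_cycles s m l w' v"
  shows "moments_agree k l w w'"
proof (rule moments_agree_if_binomial_moments_agree)
  fix j and f :: "'a \<Rightarrow> real" assume "j < k"
  obtain p :: "real poly" where p: "degree p \<le> Suc j" "\<And>x. poly p x = x gchoose Suc j"
    using ex_poly_eq_gbinomial by blast
  let ?p = "pcompose p [:0, 1 / real m:]"
  have poly_scaled: "poly ?p (real (q * m)) = real (q choose Suc j)" for q
    using assms(1) by (simp add: poly_pcompose p(2) binomial_gbinomial)
  have difference: "poly ?p (real (Suc q * m)) - poly ?p (real (q * m)) = real (q choose j)" for q
    unfolding poly_scaled by simp
  have "(\<Sum>q<l. real (q choose j) * f (w q)) = increment_sum ?p s f u (l * m)"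
    unfolding increment_sum_concat_of_cycles[OF assms(3)] difference ..
  also have "\<dots> = increment_sum ?p s f v (l * m)"
    using p(1) \<open>j < k\<close>
    by (intro moments_agree_increment_sum[OF assms(2)]) (simp add: degree_pcompose)
  also have "\<dots> = (\<Sum>q<l. real (q choose j) * f (w' q))"
    unfolding increment_sum_concat_of_cycles[OF assms(4)] difference ..
  finally show "(\<Sum>q<l. real (q choose j) * f (w q)) = (\<Sum>q<l. real (q choose j) * f (w' q))" .
qed

section \<open>Factors of the Thue--Morse word\<close>

definition cyclic_Suc :: "nat \<Rightarrow> nat \<Rightarrow> nat" where
  "cyclic_Suc m x = Suc x mod m"

lemma funpow_cyclic_Suc: "x < m \<Longrightarrow> (cyclic_Suc m ^^ r) x = (x + r) mod m"
  by (induction r) (simp_all add: cyclic_Suc_def mod_simps)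

lemma inj_on_cyclic_Suc: "inj_on (cyclic_Suc m) {..<m}"
  by (auto simp: inj_on_def cyclic_Suc_def mod_Suc split: if_splits)

lemma add_mod_eq_iff_dvd: "x < m \<Longrightarrow> (x + r) mod m = x \<longleftrightarrow> m dvd r" for m r x :: nat
  by (metis add_diff_cancel_left' le_add1 mod_eq_dvd_iff_nat mod_less)

lemma thue_morse_eq_block_head_iff:
  assumes "m \<ge> 2"
  shows "thue_morse m i = thue_morse m (i div m) \<longleftrightarrow> m dvd i"
  by (subst thue_morse_div[OF assms]) (rule add_mod_eq_iff_dvd[OF thue_morse_less[OF assms]])

lemma cyclic_Suc_thue_morse:
  assumes "m \<ge> 2"
  shows "cyclic_Suc m (thue_morse m i) = (thue_morse m (i div m) + Suc i) mod m"
  by (subst thue_morse_div[OF assms]) (simp add: cyclic_Suc_def mod_simps)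

lemma cyclic_Suc_thue_morse_eq_block_head_iff:
  assumes "m \<ge> 2"
  shows "cyclic_Suc m (thue_morse m i) = thue_morse m (i div m) \<longleftrightarrow> m dvd Suc i"
  unfolding cyclic_Suc_thue_morse[OF assms]
  by (rule add_mod_eq_iff_dvd[OF thue_morse_less[OF assms]])

lemma cut_into_cycles_thue_morse:
  assumes "m \<ge> 2"
  shows "cut_into_cycles (cyclic_Suc m) (\<lambda>i. thue_morse m ((a + i) div m)) n
    (\<lambda>i. thue_morse m (a + i))"
  unfolding cut_into_cycles_def
proof (intro allI impI)
  fix i
  let ?t = "thue_morse m"
  show "?t (a + Suc i) = cyclic_Suc m (?t (a + i)) \<and> ?t ((a + Suc i) div m) = ?t ((a + i) div m)
      \<or> cyclic_Suc m (?t (a + i)) = ?t ((a + i) div m) \<and> ?t (a + Suc i) = ?t ((a + Suc i) div m)"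
  proof (cases "m dvd a + Suc i")
    case True
    then show ?thesis
      using assms
      by (simp add: thue_morse_eq_block_head_iff cyclic_Suc_thue_morse_eq_block_head_iff)
  next
    case False
    then have same_block: "(a + Suc i) div m = (a + i) div m"
      by (simp add: div_Suc dvd_eq_mod_eq_0)
    then have "?t (a + Suc i) = cyclic_Suc m (?t (a + i))"
      using thue_morse_div[OF assms, of "a + Suc i"] by (simp add: cyclic_Suc_thue_morse[OF assms])
    then show ?thesis using same_block by simp
  qed
qed

lemma thue_morse_window_aligned:
  assumes "m \<ge> 2" "moments_agree 2 (Suc n) (\<lambda>i. thue_morse m (a + i)) (\<lambda>i. thue_morse m (b + i))"
    and "thue_morse m a \<noteq> thue_morse m b" "thue_morse m (a + n) \<noteq> thue_morse m (b + n)"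
  shows "m dvd a" "m dvd Suc n"
proof -
  have "cyclic_Suc m (thue_morse m (a + n)) \<noteq> cyclic_Suc m (thue_morse m (b + n))"
    using assms(1,4) inj_on_cyclic_Suc[of m] by (simp add: inj_on_eq_iff thue_morse_less)
  note ends = cut_into_cycles_ends[OF cut_into_cycles_thue_morse[OF assms(1)]
      cut_into_cycles_thue_morse[OF assms(1)] assms(2) _ this]
  show "m dvd a"
    using ends(1) assms(3) thue_morse_eq_block_head_iff[OF assms(1)] by simp
  moreover have "m dvd Suc (a + n)"
    using ends(2) assms(3) cyclic_Suc_thue_morse_eq_block_head_iff[OF assms(1)] by simp
  ultimately show "m dvd Suc n"
    by (metis add_Suc_right dvd_add_right_iff)
qed

lemma concat_of_cycles_thue_morse:
  assumes "m \<ge> 2"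
  shows "concat_of_cycles (cyclic_Suc m) m l
    (\<lambda>q. thue_morse m (a + q)) (\<lambda>i. thue_morse m (m * a + i))"
proof -
  have "thue_morse m (m * a + (q * m + r)) = (cyclic_Suc m ^^ r) (thue_morse m (a + q))"
    if "r < m" for q r
    using thue_morse_mult_add[OF assms that, of "a + q"] assms
    by (simp add: funpow_cyclic_Suc thue_morse_less algebra_simps)
  then show ?thesis
    using assms by (simp add: concat_of_cycles_def funpow_cyclic_Suc thue_morse_less)
qed

lemma moments_agree_thue_morse_desubstitute:
  assumes "m \<ge> 2"
    and "moments_agree (Suc (Suc k)) (Suc n) (\<lambda>i. thue_morse m (a + i)) (\<lambda>i. thue_morse m (b + i))"
    and "thue_morse m a \<noteq> thue_morse m b" "thue_morse m (a + n) \<noteq> thue_morse m (b + n)"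
  obtains l a' b' where "Suc n = l * m" "thue_morse m a' \<noteq> thue_morse m b'"
    "moments_agree (Suc k) l (\<lambda>q. thue_morse m (a' + q)) (\<lambda>q. thue_morse m (b' + q))"
proof -
  have moments_2: "moments_agree 2 (Suc n) (\<lambda>i. thue_morse m (a + i)) (\<lambda>i. thue_morse m (b + i))"
    by (rule moments_agree_mono[OF assms(2)]) simp
  have "m dvd a" "m dvd b" "m dvd Suc n"
    using thue_morse_window_aligned[OF assms(1) moments_2] assms(3,4)
      thue_morse_window_aligned[OF assms(1) moments_agree_sym[OF moments_2]] by auto
  then obtain a' b' l where aligned: "a = m * a'" "b = m * b'" "Suc n = l * m"
    by (metis dvdE mult.commute)
  have "thue_morse m a' \<noteq> thue_morse m b'"
    using assms(3) thue_morse_mult_add[OF assms(1), of 0] assms(1) unfolding aligned by auto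
  moreover have "moments_agree (Suc k) l (\<lambda>q. thue_morse m (a' + q)) (\<lambda>q. thue_morse m (b' + q))"
    by (rule moments_agree_desubstitute[OF _ assms(2)[unfolded aligned]
          concat_of_cycles_thue_morse[OF assms(1)] concat_of_cycles_thue_morse[OF assms(1)]])
      (use assms(1) in simp)
  ultimately show ?thesis using that aligned(3) by blast
qed

lemma moments_agree_thue_morse_length:
  assumes "m \<ge> 2"
    and "moments_agree (Suc k) n (\<lambda>i. thue_morse m (a + i)) (\<lambda>i. thue_morse m (b + i))"
    and "i < n" "thue_morse m (a + i) \<noteq> thue_morse m (b + i)"
  shows "2 * m ^ k \<le> n"
  using assms(2-)
proof (induction k arbitrary: n a b i)
  case 0
  have "n \<noteq> 1"
    using moments_agree_length_1[of 0 "\<lambda>i. thue_morse m (a + i)"] 0 by auto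
  then show ?case using 0 by simp
next
  case (Suc k)
  obtain c n' where trimmed: "c + Suc n' \<le> n"
    "moments_agree (Suc (Suc k)) (Suc n')
      (\<lambda>i. thue_morse m (a + (c + i))) (\<lambda>i. thue_morse m (b + (c + i)))"
    "thue_morse m (a + c) \<noteq> thue_morse m (b + c)"
    "thue_morse m (a + (c + n')) \<noteq> thue_morse m (b + (c + n'))"
    by (rule moments_agree_trim[OF Suc.prems])
  obtain l a' b' where desubstituted: "Suc n' = l * m" "thue_morse m a' \<noteq> thue_morse m b'"
    "moments_agree (Suc k) l (\<lambda>q. thue_morse m (a' + q)) (\<lambda>q. thue_morse m (b' + q))"
    by (rule moments_agree_thue_morse_desubstitute[OF assms(1) trimmed(2-4)[folded add.assoc]])
  have "0 < l" using desubstituted(1) by (cases l) auto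
  then have "2 * m ^ k \<le> l"
    using Suc.IH[OF desubstituted(3), of 0] desubstituted(2) by simp
  then have "2 * m ^ Suc k \<le> Suc n'"
    unfolding desubstituted(1) by simp
  then show ?case using trimmed(1) by simp
qed

lemma binomially_equivalent_thue_morse_factors_length:
  assumes "m \<ge> 2" "u \<in> factors (thue_morse m)" "v \<in> factors (thue_morse m)"
    and "u \<noteq> v" "binomially_equivalent (Suc k) u v"
  shows "2 * m ^ k \<le> length u"
proof -
  have same_length: "length u = length v"
    using assms(5) by (rule binomially_equivalent_length) simp
  have "\<exists>c. \<forall>i<length w. w ! i = thue_morse m (c + i)" if "w \<in> factors (thue_morse m)" for w
    using that by (auto simp: factors_def)
  then obtain a b where nth_uv: "\<And>i. i < length u \<Longrightarrow> u ! i = thue_morse m (a + i)"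
    "\<And>i. i < length u \<Longrightarrow> v ! i = thue_morse m (b + i)"
    using assms(2,3) same_length by metis
  have "moments_agree (Suc k) (length u) (\<lambda>i. thue_morse m (a + i)) (\<lambda>i. thue_morse m (b + i))"
    using binomially_equivalent_imp_moments_agree[OF assms(5) same_length]
    by (simp add: moments_agree_def nth_uv)
  moreover obtain i where "i < length u" "u ! i \<noteq> v ! i"
    using assms(4) same_length nth_equalityI by blast
  ultimately show ?thesis
    using nth_uv by (intro moments_agree_thue_morse_length[OF assms(1)]) auto
qed

lemma binomial_complexity_eq_factor_complexity:
  assumes "\<And>u v. u \<in> factors_of_length x n \<Longrightarrow> v \<in> factors_of_length x n \<Longrightarrow>
      binomially_equivalent k u v \<Longrightarrow> u = v"
  shows "binomial_complexity k x n = factor_complexity x n"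
proof -
  let ?F = "factors_of_length x n"
  have "{(u, v). u \<in> ?F \<and> v \<in> ?F \<and> binomially_equivalent k u v} = Id_on ?F"
    using assms by (auto simp: binomially_equivalent_refl)
  moreover have "?F // Id_on ?F = (\<lambda>u. {u}) ` ?F"
    by (auto simp: quotient_def)
  ultimately show ?thesis
    by (simp add: binomial_complexity_def factor_complexity_def card_image)
qed

theorem theorem1p11:
  fixes m k :: nat
  assumes "m \<ge> 2" and "k \<ge> 2"
  shows "(\<exists>u \<in> factors (thue_morse m). \<exists>v \<in> factors (thue_morse m).
            u \<noteq> v \<and> binomially_equivalent k u v \<and>
            length u = 2 * m ^ (k - 1) \<and> length v = 2 * m ^ (k - 1))
       \<and> (\<forall>u \<in> factors (thue_morse m). \<forall>v \<in> factors (thue_morse m).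
            u \<noteq> v \<and> binomially_equivalent k u v \<longrightarrow>
            length u \<ge> 2 * m ^ (k - 1) \<and> length v \<ge> 2 * m ^ (k - 1))
       \<and> (\<forall>n < 2 * m ^ (k - 1).
            binomial_complexity k (thue_morse m) n = factor_complexity (thue_morse m) n)"
proof (intro conjI ballI allI impI)
  have Suc_pred_k: "Suc (k - 1) = k" using assms(2) by simp
  show "\<exists>u \<in> factors (thue_morse m). \<exists>v \<in> factors (thue_morse m).
      u \<noteq> v \<and> binomially_equivalent k u v \<and>
      length u = 2 * m ^ (k - 1) \<and> length v = 2 * m ^ (k - 1)"
    using ex_binomially_equivalent_factors[OF assms(1), of "k - 1"] unfolding Suc_pred_k .
  note length_bound =
    binomially_equivalent_thue_morse_factors_length[OF assms(1), of _ _ "k - 1",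
      unfolded Suc_pred_k]
  show "length u \<ge> 2 * m ^ (k - 1)" "length v \<ge> 2 * m ^ (k - 1)"
    if "u \<in> factors (thue_morse m)" "v \<in> factors (thue_morse m)"
      "u \<noteq> v \<and> binomially_equivalent k u v" for u v
    using that length_bound[of u v] length_bound[of v u] by (auto intro: binomially_equivalent_sym)
  show "binomial_complexity k (thue_morse m) n = factor_complexity (thue_morse m) n"
    if "n < 2 * m ^ (k - 1)" for n
    using that length_bound
    by (intro binomial_complexity_eq_factor_complexity) (fastforce simp: factors_of_length_def)
qed

end
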